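(* Let $I_1,\ldots,I_m$ be a partition of $\{1,\ldots,n\}$. Let $\varphi(i,j)=1$ if $i,j\in I_k$ for some $k$, and $\varphi(i,j)=0$ otherwise. Let $X\subset\mathbb{C}$ be a measurable set and $\mu$ a measure on $X$. Suppose $A_i(x)$ and $B_i(x)$, $1\le i\le n$, are two sequences of functions on $X$ such that $A_i(x)B_j(x)$, $1\le i,j\le n$, are all integrable with respect to $\mathrm{d}\mu$. Then $$\det\left[\int_X A_i(x)B_j(x)\,\mathrm{d}\mu(x)\right]_{i,j=1}^n=\frac{1}{\prod_{k=1}^m|I_k|!}\int_{X^n}\det\left[A_i(x_j)\right]_{i,j=1}^n\det\left[B_i(x_j)\varphi(i,j)\right]_{i,j=1}^n\prod_{i=1}^n\mathrm{d}\mu(x_i).$$ Equivalently, $$\det\left[\int_X A_i(x)B_j(x)\,\mathrm{d}\mu(x)\right]_{i,j=1}^n=\frac{1}{\prod_{k=1}^m|I_k|!}\int_{X^n}\det\left[A_i(x_j)\right]_{i,j=1}^n\prod_{k=1}^m\det\left[B_i(x_j)\right]_{i,j\in I_k}\prod_{i=1}^n\mathrm{d}\mu(x_i).$$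
   Context: $|I_k|$ denotes the cardinality of $I_k$. Functions are complex valued. *)

theory Defs
  imports
    "HOL-Analysis.Analysis"
    "HOL-Library.Disjoint_Sets"
    "Jordan_Normal_Form.Determinant"
begin

text \<open>The determinant of \<open>[a i j]\<close> with \<open>i, j\<close> ranging over a finite index set \<open>S\<close>, rows and columns
  both listed in increasing order; the empty determinant is 1.\<close>

definition index_det :: "nat set \<Rightarrow> (nat \<Rightarrow> nat \<Rightarrow> 'a::comm_ring_1) \<Rightarrow> 'a" where
  "index_det S a = Determinant.det (Matrix.mat (card S) (card S)
     (\<lambda>(r, s). a (sorted_list_of_set S ! r) (sorted_list_of_set S ! s)))"

lemma index_det_atLeastAtMost:
  "index_det {1..n} a = Determinant.det (Matrix.mat n n (\<lambda>(r, s). a (Suc r) (Suc s)))"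
proof -
  have "sorted_list_of_set {1..n} = [1..<Suc n]"
    by (metis atLeastLessThanSuc_atLeastAtMost sorted_list_of_set_range)
  then have nth: "sorted_list_of_set {1..n} ! r = Suc r" if "r < n" for r
    using that by (simp del: upt_Suc)
  show ?thesis
    unfolding index_det_def
    by (rule arg_cong[of _ _ Determinant.det], rule eq_matI) (use nth in auto)
qed

definition same_block :: "nat \<Rightarrow> (nat \<Rightarrow> nat set) \<Rightarrow> nat \<Rightarrow> nat \<Rightarrow> complex" where
  "same_block m I i j = (if \<exists>k\<in>{1..m}. i \<in> I k \<and> j \<in> I k then 1 else 0)"

end

theory Submission
  imports Defs
begin

text \<open>
  Expanding the second determinant over the permutations \<open>\<tau>\<close> that preserve every block, and the first
  one over all permutations \<open>\<sigma>\<close>, the integral splits into products of one-variable integrals of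
  \<open>A\<^sub>i B\<^sub>j\<close>. For each fixed \<open>\<tau>\<close> the sum over \<open>\<sigma>\<close> is the determinant on the left, by reindexing
  \<open>\<sigma>\<close> to \<open>\<tau>\<^sup>-\<^sup>1 \<circ> \<sigma>\<close>, and there are \<open>\<Prod>\<^sub>k |I\<^sub>k|!\<close> choices of \<open>\<tau>\<close>.

  The measure need not be \<open>\<sigma>\<close>-finite, so Fubini's theorem does not apply directly. A product
  measure still exists by Caratheodory extension, although it need not be unique; but each
  integrable factor lives on a \<open>\<sigma>\<close>-finite set, and on a box of \<open>\<sigma>\<close>-finite sets all product measures agree.
\<close>

section \<open>Finite products of arbitrary measures\<close>

text \<open>Only a semiring of rectangles is used, where the iterated integral \<open>f\<close>
  makes sense without sigma-finiteness: on a rectangle the slice measure is a constant times an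
  indicator, hence measurable. Caratheodory then extends \<open>f\<close> to the product
  sigma-algebra. Uniqueness is not claimed and can fail.\<close>

lemma ex_product_measure:
  fixes M :: "'a measure" and N :: "'b measure"
  shows "\<exists>P. sets P = sets (M \<Otimes>\<^sub>M N) \<and>
    (\<forall>A\<in>sets M. \<forall>B\<in>sets N. emeasure P (A \<times> B) = emeasure M A * emeasure N B)"
proof -
  let ?R = "{A \<times> B | A B. A \<in> sets M \<and> B \<in> sets N}"
  define f where "f = (\<lambda>R. \<integral>\<^sup>+x. emeasure N (Pair x -` R) \<partial>M)"
  have slice: "emeasure N (Pair x -` (A \<times> B)) = emeasure N B * indicator A x" for A x and B :: "'b set"
    by (auto simp: indicator_def)
  have f_Times: "f (A \<times> B) = emeasure M A * emeasure N B"
    if "A \<in> sets M" "B \<in> sets N" for A B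
    using that unfolding f_def slice by (subst nn_integral_cmult_indicator) (auto simp: mult.commute)
  interpret semiring_of_sets "space M \<times> space N" ?R
  proof
    show "?R \<subseteq> Pow (space M \<times> space N)"
      using pair_measure_closed .
    show "{} \<in> ?R"
      by blast
    fix a b assume "a \<in> ?R" "b \<in> ?R"
    then obtain A B C D where a: "a = A \<times> B" and b: "b = C \<times> D"
      and sets: "A \<in> sets M" "B \<in> sets N" "C \<in> sets M" "D \<in> sets N"
      by blast
    show "a \<inter> b \<in> ?R"
      using sets unfolding a b Times_Int_Times by blast
    \<comment> \<open>The difference splits by the first coordinate: outside \<open>C\<close> all of
      \<open>B\<close> survives, inside \<open>C\<close> only \<open>B - D\<close> does.\<close>
    have "a - b = \<Union>{(A - C) \<times> B, (A \<inter> C) \<times> (B - D)}"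
      unfolding a b by auto
    moreover have "disjoint {(A - C) \<times> B, (A \<inter> C) \<times> (B - D)}"
      by (auto simp: disjoint_def)
    moreover have "{(A - C) \<times> B, (A \<inter> C) \<times> (B - D)} \<subseteq> ?R"
      using sets by blast
    ultimately show "\<exists>C\<subseteq>?R. finite C \<and> disjoint C \<and> a - b = \<Union>C"
      by (intro exI[of _ "{(A - C) \<times> B, (A \<inter> C) \<times> (B - D)}"]) simp
  qed
  have measurable: "(\<lambda>x. emeasure N (Pair x -` R)) \<in> borel_measurable M" if "R \<in> ?R" for R
    using that by (auto simp: slice)
  have "positive ?R f"
    by (simp add: positive_def f_def)
  moreover have "countably_additive ?R f"
  proof (rule countably_additiveI)
    fix R :: "nat \<Rightarrow> ('a \<times> 'b) set"
    assume R: "range R \<subseteq> ?R" and disj: "disjoint_family R"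
    \<comment> \<open>Slices at a fixed \<open>x\<close> of disjoint rectangles are disjoint, so
      \<open>N\<close> is countably additive along them; exchanging sum and integral over
      \<open>M\<close> then gives countable additivity of \<open>f\<close>.\<close>
    have "(\<Sum>i. emeasure N (Pair x -` R i)) = emeasure N (\<Union>i. Pair x -` R i)" for x
    proof (rule suminf_emeasure)
      have "Pair x -` Q \<in> sets N" if "Q \<in> ?R" for Q
        using that by auto
      then show "range (\<lambda>i. Pair x -` R i) \<subseteq> sets N"
        using R by blast
      show "disjoint_family (\<lambda>i. Pair x -` R i)"
        using disj by (auto simp: disjoint_family_on_def)
    qed
    moreover have "(\<lambda>x. emeasure N (Pair x -` R i)) \<in> borel_measurable M" for i
      using R by (intro measurable) blast
    ultimately show "(\<Sum>i. f (R i)) = f (\<Union>i. R i)"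
      unfolding f_def vimage_UN by (simp add: nn_integral_suminf[symmetric])
  qed
  ultimately obtain \<mu> where \<mu>: "\<forall>R\<in>?R. \<mu> R = f R"
    "measure_space (space M \<times> space N) (sigma_sets (space M \<times> space N) ?R) \<mu>"
    using caratheodory by blast
  define P where "P = measure_of (space M \<times> space N) ?R \<mu>"
  have P: "sets P = sigma_sets (space M \<times> space N) ?R"
    unfolding P_def by (rule sets_measure_of) (rule pair_measure_closed)
  have "emeasure P (A \<times> B) = emeasure M A * emeasure N B" if "A \<in> sets M" "B \<in> sets N" for A B
  proof -
    have "A \<times> B \<in> ?R"
      using that by blast
    moreover have "emeasure P (A \<times> B) = \<mu> (A \<times> B)"
      using \<mu>(2) calculation unfolding P
      by (intro emeasure_measure_of[OF P_def pair_measure_closed])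
         (auto simp: measure_space_def P simp del: P_def intro: sigma_sets.Basic)
    ultimately show ?thesis
      using \<mu>(1) f_Times[OF that] by simp
  qed
  then show ?thesis
    using P by (auto simp: sets_pair_measure)
qed

text \<open>Add one coordinate at a time: take a product of the measure on \<open>I\<close> with
  \<open>M i\<close>, and push it forward along \<open>f(i := y)\<close>.\<close>

lemma ex_finite_product_measure:
  assumes "finite I"
  shows "\<exists>P. sets P = sets (PiM I M) \<and>
    (\<forall>A. (\<forall>i\<in>I. A i \<in> sets (M i)) \<longrightarrow> emeasure P (Pi\<^sub>E I A) = (\<Prod>i\<in>I. emeasure (M i) (A i)))"
  using assms
proof (induction I rule: finite_induct)
  case empty
  show ?case
    by (intro exI[of _ "PiM {} M"]) simp
next
  case (insert i I)
  then obtain P where P: "sets P = sets (PiM I M)"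
    "\<And>A. (\<forall>i\<in>I. A i \<in> sets (M i)) \<Longrightarrow> emeasure P (Pi\<^sub>E I A) = (\<Prod>i\<in>I. emeasure (M i) (A i))"
    by blast
  obtain Q where Q: "sets Q = sets (P \<Otimes>\<^sub>M M i)"
    "\<And>A B. A \<in> sets P \<Longrightarrow> B \<in> sets (M i) \<Longrightarrow> emeasure Q (A \<times> B) = emeasure P A * emeasure (M i) B"
    using ex_product_measure[of P "M i"] by blast
  let ?h = "\<lambda>(f, y). f(i := y)"
  have sets_Q: "sets Q = sets (PiM I M \<Otimes>\<^sub>M M i)"
    unfolding Q(1) by (rule sets_pair_measure_cong[OF P(1) refl])
  have h: "?h \<in> measurable Q (PiM (insert i I) M)"
    unfolding measurable_cong_sets[OF sets_Q refl] by (rule measurable_add_dim)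
  have "emeasure (distr Q (PiM (insert i I) M) ?h) (Pi\<^sub>E (insert i I) A) =
      (\<Prod>j\<in>insert i I. emeasure (M j) (A j))" if A: "\<forall>j\<in>insert i I. A j \<in> sets (M j)" for A
  proof -
    have "emeasure (distr Q (PiM (insert i I) M) ?h) (Pi\<^sub>E (insert i I) A) =
        emeasure Q (?h -` Pi\<^sub>E (insert i I) A \<inter> space Q)"
      using A \<open>finite I\<close> by (intro emeasure_distr[OF h] sets_PiM_I_finite) auto
    also have "?h -` Pi\<^sub>E (insert i I) A \<inter> space Q = Pi\<^sub>E I A \<times> A i"
      using A[rule_format, THEN sets.sets_into_space] \<open>i \<notin> I\<close>
      unfolding sets_eq_imp_space_eq[OF sets_Q]
      by (auto simp: space_pair_measure space_PiM PiE_iff extensional_def fun_upd_def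
          split: if_split_asm)
    also have "emeasure Q \<dots> = emeasure P (Pi\<^sub>E I A) * emeasure (M i) (A i)"
      using A \<open>finite I\<close> by (intro Q(2)) (auto simp: P(1) intro!: sets_PiM_I_finite)
    also have "\<dots> = (\<Prod>j\<in>insert i I. emeasure (M j) (A j))"
      using A insert.hyps by (simp add: P(2) mult.commute)
    finally show ?thesis .
  qed
  then show ?case
    by (intro exI[of _ "distr Q (PiM (insert i I) M) ?h"]) auto
qed

text \<open>\<open>PiM\<close> is defined through \<open>extend_measure\<close>, which attains the
  prescribed values on the generators as soon as some measure attains them. The measure
  \<open>P\<close> is such a witness, so the formula holds whichever product measure
  \<open>PiM\<close> happens to select.\<close>

lemma emeasure_PiM_Pi:
  assumes "finite I" and A: "\<And>i. i \<in> I \<Longrightarrow> A i \<in> sets (M i)"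
  shows "emeasure (PiM I M) (Pi\<^sub>E I A) = (\<Prod>i\<in>I. emeasure (M i) (A i))"
proof -
  obtain P where P: "sets P = sets (PiM I M)"
    "\<And>A. (\<forall>i\<in>I. A i \<in> sets (M i)) \<Longrightarrow> emeasure P (Pi\<^sub>E I A) = (\<Prod>i\<in>I. emeasure (M i) (A i))"
    using ex_finite_product_measure[OF \<open>finite I\<close>, of M] by blast
  \<comment> \<open>This odd index set comes from \<open>PiM_def\<close>: a cylinder over
    \<open>J\<close> also gets the total masses of the other coordinates, those of mass 1 being left
    out. For \<open>J = I\<close> it collapses to \<open>I\<close>.\<close>
  have "emeasure (PiM I M) (prod_emb I M I (Pi\<^sub>E I A)) =
    (\<Prod>j\<in>I \<union> {i\<in>I. emeasure (M i) (space (M i)) \<noteq> 1}.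
       if j \<in> I then emeasure (M j) (A j) else emeasure (M j) (space (M j)))"
  proof (rule emeasure_extend_measure_Pair[OF PiM_def])
    show "positive (sets (PiM I M)) (emeasure P)" "countably_additive (sets (PiM I M)) (emeasure P)"
      using emeasure_positive[of P] emeasure_countably_additive[of P] by (simp_all add: P(1))
    show "(I \<noteq> {} \<or> I = {}) \<and> finite I \<and> I \<subseteq> I \<and> A \<in> (\<Pi> j\<in>I. sets (M j))"
      using assms by auto
  next
    fix J E
    assume "(J \<noteq> {} \<or> I = {}) \<and> finite J \<and> J \<subseteq> I \<and> E \<in> (\<Pi> j\<in>J. sets (M j))"
    then have J: "J \<subseteq> I" and E: "\<And>j. j \<in> J \<Longrightarrow> E j \<in> sets (M j)"
      by auto
    have emb: "prod_emb I M J (Pi\<^sub>E J E) = (\<Pi>\<^sub>E j\<in>I. if j \<in> J then E j else space (M j))"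
      using J E by (intro prod_emb_Pi) auto
    show "prod_emb I M J (Pi\<^sub>E J E) \<in> Pow (\<Pi>\<^sub>E i\<in>I. space (M i))"
      by (auto simp: prod_emb_def)
    have "emeasure P (prod_emb I M J (Pi\<^sub>E J E)) =
        (\<Prod>j\<in>I. if j \<in> J then emeasure (M j) (E j) else emeasure (M j) (space (M j)))"
      unfolding emb using E by (subst P(2)) (auto intro!: prod.cong)
    also have "\<dots> = (\<Prod>j\<in>J \<union> {i\<in>I. emeasure (M i) (space (M i)) \<noteq> 1}.
        if j \<in> J then emeasure (M j) (E j) else emeasure (M j) (space (M j)))"
      using J \<open>finite I\<close> by (intro prod.mono_neutral_right) auto
    finally show "emeasure P (prod_emb I M J (Pi\<^sub>E J E)) = \<dots>" .
  qed
  moreover have "prod_emb I M I (Pi\<^sub>E I A) = Pi\<^sub>E I A"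
    using A by (intro prod_emb_PiE_same_index sets.sets_into_space) auto
  moreover have "I \<union> {i\<in>I. emeasure (M i) (space (M i)) \<noteq> 1} = I"
    by auto
  ultimately show ?thesis
    by simp
qed

section \<open>Product integrals by restriction to sigma-finite supports\<close>

text \<open>By Markov's inequality the sets \<open>norm (f x) >= 1 / Suc n\<close> have finite
  measure. They exhaust the support of \<open>f\<close>, and the zero set is null for the restricted
  measure. Restricting by a density keeps the space and the sigma-algebra of
  \<open>M\<close>.\<close>

lemma sigma_finite_density_support:
  fixes f :: "'a \<Rightarrow> 'b::{banach, second_countable_topology}"
  assumes f: "integrable M f"
  shows "sigma_finite_measure (density M (\<lambda>x. indicator {x \<in> space M. f x \<noteq> 0} x))"
    (is "sigma_finite_measure ?N")
proof
  have [measurable]: "f \<in> borel_measurable M"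
    using f by (rule borel_measurable_integrable)
  define C where "C = (\<lambda>n::nat. {x \<in> space M. norm (f x) \<ge> 1 / Suc n})"
  have C [measurable]: "C n \<in> sets M" for n
    unfolding C_def by measurable
  have "emeasure ?N (C n) \<noteq> \<infinity>" for n
  proof -
    have "emeasure ?N (C n) = emeasure M ({x \<in> space M. f x \<noteq> 0} \<inter> C n)"
      by (rule emeasure_restricted) measurable
    also have "\<dots> \<le> emeasure M (C n)"
      by (rule emeasure_mono) measurable
    also have "\<dots> \<le> (1 / (1 / Suc n)) * (\<integral>x. norm (f x) \<partial>M)"
      unfolding C_def using f by (intro integral_Markov_inequality) auto
    finally show ?thesis
      by (auto simp: top_unique)
  qed
  moreover have "emeasure ?N {x \<in> space M. f x = 0} = 0"
  proof -
    have "emeasure ?N {x \<in> space M. f x = 0} =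
        emeasure M ({x \<in> space M. f x \<noteq> 0} \<inter> {x \<in> space M. f x = 0})"
      by (rule emeasure_restricted) measurable
    also have "{x \<in> space M. f x \<noteq> 0} \<inter> {x \<in> space M. f x = 0} = {}"
      by auto
    finally show ?thesis
      by simp
  qed
  moreover have "(\<Union>n. C n) \<union> {x \<in> space M. f x = 0} = space M"
  proof -
    have "\<exists>n. x \<in> C n" if "x \<in> space M" "f x \<noteq> 0" for x
    proof -
      obtain n where "1 / Suc n < norm (f x)"
        using nat_approx_posE[of "norm (f x)"] \<open>f x \<noteq> 0\<close> by auto
      then have "x \<in> C n"
        unfolding C_def using \<open>x \<in> space M\<close> by (intro CollectI conjI less_imp_le)
      then show ?thesis ..
    qed
    moreover have "C n \<subseteq> space M" for n
      unfolding C_def by (rule Collect_restrict)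
    ultimately show ?thesis
      by blast
  qed
  ultimately show "\<exists>A. countable A \<and> A \<subseteq> sets ?N \<and> \<Union>A = space ?N \<and> (\<forall>a\<in>A. emeasure ?N a \<noteq> \<infinity>)"
    by (intro exI[of _ "insert {x \<in> space M. f x = 0} (range C)"]) auto
qed

text \<open>The integrand vanishes off the box of the supports \<open>S i\<close>. On that box
  \<open>PiM I M\<close> coincides with the product of the restricted measures \<open>N i\<close>,
  which are sigma-finite, so the usual Fubini statement for products applies there.\<close>

lemma integral_PiM_prod:
  fixes f :: "'i \<Rightarrow> 'a \<Rightarrow> 'b::{real_normed_field, banach, second_countable_topology}"
  assumes I: "finite I" and f: "\<And>i. i \<in> I \<Longrightarrow> integrable (M i) (f i)"
  shows "integrable (PiM I M) (\<lambda>x. \<Prod>i\<in>I. f i (x i))" (is ?integrable)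
    and "(\<integral>x. (\<Prod>i\<in>I. f i (x i)) \<partial>PiM I M) = (\<Prod>i\<in>I. \<integral>x. f i x \<partial>M i)" (is ?integral)
proof -
  define S where "S i = {x \<in> space (M i). f i x \<noteq> 0}" for i
  \<comment> \<open>The locale \<open>product_sigma_finite\<close> asks for sigma-finiteness at
    every index, so indices outside \<open>I\<close> receive the trivial measure
    \<open>count_space {}\<close>.\<close>
  define N where "N i = (if i \<in> I then density (M i) (\<lambda>x. ennreal (indicator (S i) x))
    else count_space {})" for i
  have f_meas [measurable]: "f i \<in> borel_measurable (M i)" if "i \<in> I" for i
    using f[OF that] by (rule borel_measurable_integrable)
  have S [measurable]: "S i \<in> sets (M i)" if "i \<in> I" for i
    unfolding S_def using that by measurable
  have "sigma_finite_measure (N i)" for i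
    using sigma_finite_density_support[OF f[of i]]
    by (auto simp: N_def S_def ennreal_indicator sigma_finite_measure_count_space_finite)
  then interpret N: product_sigma_finite N
    by (simp add: product_sigma_finite_def)
  have sets_N: "sets (PiM I N) = sets (PiM I M)"
    by (rule sets_PiM_cong) (auto simp: N_def)
  have box: "Pi\<^sub>E I S \<in> sets (PiM I M)"
    using I S by (intro sets_PiM_I_finite) auto
  \<comment> \<open>A product of sigma-finite measures is determined by its values on boxes. Both
    sides agree on them by \<open>emeasure_PiM_Pi\<close>, since intersecting with the box
    \<open>Pi\<^sub>E I S\<close> acts coordinatewise.\<close>
  have "density (PiM I M) (\<lambda>x. ennreal (indicator (Pi\<^sub>E I S) x)) = PiM I N"
  proof (rule N.PiM_eqI[OF I])
    fix A assume "\<And>i. i \<in> I \<Longrightarrow> A i \<in> sets (N i)"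
    then have A: "A i \<in> sets (M i)" if "i \<in> I" for i
      using that by (auto simp: N_def)
    then have "Pi\<^sub>E I A \<in> sets (PiM I M)"
      using I by (intro sets_PiM_I_finite) auto
    then have "emeasure (density (PiM I M) (\<lambda>x. ennreal (indicator (Pi\<^sub>E I S) x))) (Pi\<^sub>E I A) =
        emeasure (PiM I M) (Pi\<^sub>E I S \<inter> Pi\<^sub>E I A)"
      using box by (simp add: ennreal_indicator emeasure_restricted)
    also have "\<dots> = (\<Prod>i\<in>I. emeasure (M i) (S i \<inter> A i))"
      unfolding PiE_Int using I S A by (intro emeasure_PiM_Pi) auto
    also have "\<dots> = (\<Prod>i\<in>I. emeasure (N i) (A i))"
      using S A by (intro prod.cong) (auto simp: N_def ennreal_indicator emeasure_restricted)
    finally show "emeasure (density (PiM I M) (\<lambda>x. ennreal (indicator (Pi\<^sub>E I S) x))) (Pi\<^sub>E I A) =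
        (\<Prod>i\<in>I. emeasure (N i) (A i))" .
  qed (simp add: sets_N)
  note restrict = this
  have meas: "(\<lambda>x. \<Prod>i\<in>I. f i (x i)) \<in> borel_measurable (PiM I M)"
    by measurable
  \<comment> \<open>A point outside the box has a coordinate where \<open>f i\<close> is zero, which
    kills the whole product.\<close>
  have supp: "indicator (Pi\<^sub>E I S) x *\<^sub>R (\<Prod>i\<in>I. f i (x i)) = (\<Prod>i\<in>I. f i (x i))"
    if "x \<in> space (PiM I M)" for x
    using that I by (auto simp: indicator_def S_def space_PiM PiE_iff)
  have supp1: "indicator (S i) x *\<^sub>R f i x = f i x" if "x \<in> space (M i)" for i x
    using that by (auto simp: indicator_def S_def)
  have f_N: "integrable (N i) (f i)" "(\<integral>x. f i x \<partial>N i) = (\<integral>x. f i x \<partial>M i)" if "i \<in> I" for i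
    using that f[OF that] supp1
    by (auto simp: N_def integrable_density integral_density cong: Bochner_Integration.integrable_cong
          Bochner_Integration.integral_cong)
  have "integrable (PiM I N) (\<lambda>x. \<Prod>i\<in>I. f i (x i))"
    using I f_N by (intro N.product_integrable_prod) auto
  then show ?integrable
    using supp box meas unfolding restrict[symmetric]
    by (simp add: integrable_density cong: Bochner_Integration.integrable_cong)
  have "(\<integral>x. (\<Prod>i\<in>I. f i (x i)) \<partial>PiM I M) = (\<integral>x. (\<Prod>i\<in>I. f i (x i)) \<partial>PiM I N)"
    using supp box meas unfolding restrict[symmetric]
    by (simp add: integral_density cong: Bochner_Integration.integral_cong)
  also have "\<dots> = (\<Prod>i\<in>I. \<integral>x. f i x \<partial>M i)"
    using I f_N by (subst N.product_integral_prod) auto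
  finally show ?integral .
qed

section \<open>Determinants and block permutations\<close>

text \<open>The increasing enumeration of \<open>S\<close> transports permutations of matrix
  positions to permutations of \<open>S\<close>, and this conjugation preserves signs. From here on
  no matrix positions occur.\<close>

lemma index_det_Leibniz:
  assumes S: "finite S"
  shows "index_det S a = (\<Sum>p | p permutes S. of_int (sign p) * (\<Prod>i\<in>S. a i (p i)))"
proof -
  let ?n = "card S" and ?l = "\<lambda>r. sorted_list_of_set S ! r"
  have bij: "bij_betw ?l {0..<?n} S"
    using bij_betw_nth[of "sorted_list_of_set S" "{..<card S}" S] S
    by (simp add: lessThan_atLeast0)
  then have inj: "inj_on ?l {0..<?n}"
    by (rule bij_betw_imp_inj_on)
  let ?m = "map_permutation {0..<?n} ?l"
  have "index_det S a =
      (\<Sum>p | p permutes {0..<?n}. of_int (sign p) * (\<Prod>r = 0..<?n. a (?l r) (?l (p r))))"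
    unfolding index_det_def
    by (subst Determinant.det_def'[of _ ?n])
       (auto intro!: sum.cong prod.cong arg_cong2[where f="(*)"]
         simp: permutes_in_image[of _ "{0..<card S}", simplified])
  also have "\<dots> = (\<Sum>p | p permutes {0..<?n}. of_int (sign (?m p)) * (\<Prod>i\<in>S. a i (?m p i)))"
  proof (rule sum.cong[OF refl])
    fix p assume "p \<in> {p. p permutes {0..<?n}}"
    then have p: "p permutes {0..<?n}"
      by simp
    have "(\<Prod>i\<in>S. a i (?m p i)) = (\<Prod>r = 0..<?n. a (?l r) (?m p (?l r)))"
      by (rule prod.reindex_bij_betw[OF bij, symmetric])
    also have "\<dots> = (\<Prod>r = 0..<?n. a (?l r) (?l (p r)))"
      by (intro prod.cong) (simp_all add: map_permutation_apply[OF inj])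
    finally show "of_int (sign p) * (\<Prod>r = 0..<?n. a (?l r) (?l (p r))) =
        of_int (sign (?m p)) * (\<Prod>i\<in>S. a i (?m p i))"
      using sign_map_permutation[OF inj p] by simp
  qed
  also have "\<dots> = (\<Sum>p | p permutes S. of_int (sign p) * (\<Prod>i\<in>S. a i (p i)))"
  proof (rule sum.reindex_bij_betw)
    show "bij_betw ?m {p. p permutes {0..<?n}} {p. p permutes S}"
      using bij_betw_permutations[OF bij] bij_betw_imp_surj_on[OF bij]
      by (simp add: map_permutation_def[abs_def] restrict_id_def comp_def)
  qed
  finally show ?thesis .
qed


section \<open>Permutations preserving every block\<close>

text \<open>For disjoint blocks this is the Young subgroup of the partition. Asking only that
  \<open>p\<close> map each block into itself suffices: \<open>p\<close> is injective, so it maps a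
  finite block onto itself.\<close>

definition block_permutations :: "'k set \<Rightarrow> ('k \<Rightarrow> 'a set) \<Rightarrow> ('a \<Rightarrow> 'a) set" where
  "block_permutations K I = {p. p permutes (\<Union>k\<in>K. I k) \<and> (\<forall>k\<in>K. \<forall>i\<in>I k. p i \<in> I k)}"

text \<open>Splitting off one block: the inverse map restricts a permutation to \<open>I k\<close>
  and to the union of the other blocks. This carries the inductions for both the count and the
  determinant product.\<close>

lemma bij_betw_block_permutations_insert:
  assumes K: "finite K" "k \<notin> K" and fin: "\<And>l. l \<in> insert k K \<Longrightarrow> finite (I l)"
    and disj: "disjoint_family_on I (insert k K)"
  shows "bij_betw (\<lambda>(p, q). p \<circ> q) ({p. p permutes I k} \<times> block_permutations K I)
    (block_permutations (insert k K) I)"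
proof (rule bij_betw_byWitness[of _ "\<lambda>r. (restrict_id r (I k), restrict_id r (\<Union>l\<in>K. I l))"])
  let ?U = "\<Union>l\<in>K. I l"
  have disj_U: "I k \<inter> ?U = {}"
    using K disj by (fastforce simp: disjoint_family_on_def)
  \<comment> \<open>The two permutations have disjoint supports: \<open>q\<close> fixes
    \<open>I k\<close> pointwise and maps its complement to itself, where \<open>p\<close> is the
    identity.\<close>
  have comp: "(p \<circ> q) i = (if i \<in> I k then p i else q i)"
    if "p permutes I k" "q permutes ?U" for p q i
  proof (cases "i \<in> I k")
    case True
    then have "q i = i"
      using disj_U permutes_not_in[OF that(2), of i] by blast
    then show ?thesis
      using True by simp
  next
    case False
    then have "q i \<notin> I k"
      using disj_U permutes_in_image[OF that(2), of i] permutes_not_in[OF that(2), of i]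
      by (cases "i \<in> ?U") auto
    then show ?thesis
      using False permutes_not_in[OF that(1)] by simp
  qed
  show "\<forall>x\<in>{p. p permutes I k} \<times> block_permutations K I.
      (restrict_id (case x of (p, q) \<Rightarrow> p \<circ> q) (I k), restrict_id (case x of (p, q) \<Rightarrow> p \<circ> q) ?U) = x"
  proof
    fix x assume "x \<in> {p. p permutes I k} \<times> block_permutations K I"
    then obtain p q where x: "x = (p, q)" and p: "p permutes I k" and q: "q permutes ?U"
      by (auto simp: block_permutations_def)
    have "restrict_id (p \<circ> q) (I k) = p" "restrict_id (p \<circ> q) ?U = q"
      using disj_U p q by (auto simp: fun_eq_iff restrict_id_def comp[OF p q] simp del: comp_apply
          dest: permutes_not_in)
    then show "(restrict_id (case x of (p, q) \<Rightarrow> p \<circ> q) (I k),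
        restrict_id (case x of (p, q) \<Rightarrow> p \<circ> q) ?U) = x"
      by (simp add: x)
  qed
  show "(\<lambda>(p, q). p \<circ> q) ` ({p. p permutes I k} \<times> block_permutations K I)
      \<subseteq> block_permutations (insert k K) I"
  proof safe
    fix p q assume p: "p permutes I k" and "q \<in> block_permutations K I"
    then have q: "q permutes ?U" "\<And>l i. l \<in> K \<Longrightarrow> i \<in> I l \<Longrightarrow> q i \<in> I l"
      by (auto simp: block_permutations_def)
    have "(p \<circ> q) permutes (\<Union>l\<in>insert k K. I l)"
      by (rule permutes_compose; rule permutes_subset) (use p q in auto)
    moreover have "(p \<circ> q) i \<in> I l" if "l \<in> insert k K" "i \<in> I l" for l i
      unfolding comp[OF p q(1)] using that p q(2) disj_U by (auto simp: permutes_in_image)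
    ultimately show "p \<circ> q \<in> block_permutations (insert k K) I"
      by (simp add: block_permutations_def)
  qed
  have restrict: "restrict_id r (I k) permutes I k" "restrict_id r ?U permutes ?U"
    if r: "r \<in> block_permutations (insert k K) I" for r
  proof -
    have "inj r"
      using r by (auto simp: block_permutations_def intro: permutes_inj)
    \<comment> \<open>An injective self-map of a finite set is onto; this turns the inclusions in
      \<open>block_permutations\<close> into bijections.\<close>
    then have bij: "bij_betw r S S" if "finite S" "r ` S \<subseteq> S" for S
      using that endo_inj_surj[of S r] by (auto simp: bij_betw_def intro: inj_on_subset)
    have "bij_betw r (I k) (I k)" "bij_betw r ?U ?U"
      by (rule bij; use r K fin in \<open>force simp: block_permutations_def\<close>)+
    then show "restrict_id r (I k) permutes I k" "restrict_id r ?U permutes ?U"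
      by (simp_all add: permutes_restrict_id)
  qed
  show "\<forall>r\<in>block_permutations (insert k K) I.
      (case (restrict_id r (I k), restrict_id r ?U) of (p, q) \<Rightarrow> p \<circ> q) = r"
  proof
    fix r assume r: "r \<in> block_permutations (insert k K) I"
    have "r i = i" if "i \<notin> I k" "i \<notin> ?U" for i
      using r that by (auto simp: block_permutations_def permutes_def)
    then have "(restrict_id r (I k) \<circ> restrict_id r ?U) i = r i" for i
      unfolding comp[OF restrict[OF r]] by (auto simp: restrict_id_def)
    then have "restrict_id r (I k) \<circ> restrict_id r ?U = r"
      by (rule ext)
    then show "(case (restrict_id r (I k), restrict_id r ?U) of (p, q) \<Rightarrow> p \<circ> q) = r"
      by simp
  qed
  show "(\<lambda>r. (restrict_id r (I k), restrict_id r ?U)) ` block_permutations (insert k K) I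
      \<subseteq> {p. p permutes I k} \<times> block_permutations K I"
    using restrict by (auto simp: block_permutations_def restrict_id_def)
qed

lemma card_block_permutations:
  assumes "finite K" "\<And>k. k \<in> K \<Longrightarrow> finite (I k)" "disjoint_family_on I K"
  shows "card (block_permutations K I) = (\<Prod>k\<in>K. fact (card (I k)))"
  using assms
proof (induction K rule: finite_induct)
  case empty
  show ?case
    by (simp add: block_permutations_def)
next
  case (insert k K)
  have "card (block_permutations (insert k K) I) =
      card ({p. p permutes I k} \<times> block_permutations K I)"
    using insert.prems
    by (intro bij_betw_same_card[symmetric, OF bij_betw_block_permutations_insert] insert.hyps)
  also have "\<dots> = (\<Prod>k\<in>insert k K. fact (card (I k)))"
    using insert
    by (simp add: card_cartesian_product card_permutations disjoint_family_on_mono[OF subset_insertI])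
  finally show ?case .
qed

text \<open>Multiplying out the Leibniz expansions chooses one permutation per block. Such a choice
  amounts to a single block permutation, whose sign is the product of the chosen signs.\<close>

lemma prod_index_det_blocks:
  assumes "finite K" "\<And>k. k \<in> K \<Longrightarrow> finite (I k)" "disjoint_family_on I K"
  shows "(\<Prod>k\<in>K. index_det (I k) a) =
    (\<Sum>p\<in>block_permutations K I. of_int (sign p) * (\<Prod>i\<in>(\<Union>k\<in>K. I k). a i (p i)))"
  using assms
proof (induction K rule: finite_induct)
  case empty
  show ?case
    by (simp add: block_permutations_def)
next
  case (insert k K)
  let ?U = "\<Union>l\<in>K. I l"
  let ?P = "{p. p permutes I k}" and ?Q = "block_permutations K I"
  let ?t = "\<lambda>S p. of_int (sign p) * (\<Prod>i\<in>S. a i (p i))"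
  have fin: "finite (I k)" "finite ?U"
    using insert by auto
  have disj: "I k \<inter> ?U = {}"
    using insert.hyps insert.prems(2) by (fastforce simp: disjoint_family_on_def)
  have "(\<Prod>l\<in>insert k K. index_det (I l) a) = (\<Sum>p\<in>?P. ?t (I k) p) * (\<Sum>q\<in>?Q. ?t ?U q)"
    using insert fin disjoint_family_on_mono[OF subset_insertI insert.prems(2)]
    by (simp add: index_det_Leibniz)
  also have "\<dots> = (\<Sum>(p, q)\<in>?P \<times> ?Q. ?t (I k) p * ?t ?U q)"
    by (simp add: sum_product sum.cartesian_product)
  also have "\<dots> = (\<Sum>x\<in>?P \<times> ?Q. ?t (I k \<union> ?U) (case x of (p, q) \<Rightarrow> p \<circ> q))"
  proof (rule sum.cong[OF refl], clarify)
    fix p q assume p: "p permutes I k" and "q \<in> ?Q"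
    then have q: "q permutes ?U"
      by (simp add: block_permutations_def)
    have "sign (p \<circ> q) = sign p * sign q"
      using p q fin by (intro sign_compose) (auto intro: permutes_imp_permutation)
    moreover have "(\<Prod>i\<in>I k. a i ((p \<circ> q) i)) = (\<Prod>i\<in>I k. a i (p i))"
      using disj permutes_not_in[OF q] by (intro prod.cong) (auto simp: disjoint_iff)
    moreover have "(\<Prod>i\<in>?U. a i ((p \<circ> q) i)) = (\<Prod>i\<in>?U. a i (q i))"
    proof (intro prod.cong refl)
      fix i assume "i \<in> ?U"
      then have "q i \<in> ?U"
        using q by (simp only: permutes_in_image)
      then have "p (q i) = q i"
        using disj p by (auto simp: permutes_def)
      then show "a i ((p \<circ> q) i) = a i (q i)"
        by simp
    qed
    ultimately show "?t (I k) p * ?t ?U q = ?t (I k \<union> ?U) (p \<circ> q)"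
      using prod.union_disjoint[OF fin disj, of "\<lambda>i. a i ((p \<circ> q) i)"]
      by (simp del: comp_apply add: mult_ac)
  qed
  also have "\<dots> = (\<Sum>r\<in>block_permutations (insert k K) I. ?t (I k \<union> ?U) r)"
    using insert.prems
    by (intro sum.reindex_bij_betw bij_betw_block_permutations_insert insert.hyps)
  finally show ?case
    by simp
qed

text \<open>This is the determinant of a block diagonal matrix up to ordering of the indices. A
  permutation moving some index out of its block meets a zero factor, so only the block permutations
  contribute.\<close>

lemma index_det_same_block:
  assumes S: "finite S" "S = (\<Union>k\<in>{1..m}. I k)" and disj: "disjoint_family_on I {1..m}"
  shows "index_det S (\<lambda>i j. b i j * same_block m I i j) = (\<Prod>k=1..m. index_det (I k) b)"
proof -
  let ?G = "block_permutations {1..m} I"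
  have "(\<Prod>k=1..m. index_det (I k) b) = (\<Sum>p\<in>?G. of_int (sign p) * (\<Prod>i\<in>S. b i (p i)))"
    unfolding S(2) using S by (intro prod_index_det_blocks disj) auto
  also have "\<dots> = (\<Sum>p | p permutes S. of_int (sign p) * (\<Prod>i\<in>S. b i (p i) * same_block m I i (p i)))"
  proof (rule sum.mono_neutral_cong_left)
    show "finite {p. p permutes S}"
      using S(1) by (rule finite_permutations)
    show "?G \<subseteq> {p. p permutes S}"
      by (auto simp: block_permutations_def S(2))
    show "of_int (sign p) * (\<Prod>i\<in>S. b i (p i)) =
        of_int (sign p) * (\<Prod>i\<in>S. b i (p i) * same_block m I i (p i))" if "p \<in> ?G" for p
    proof -
      have "same_block m I i (p i) = 1" if "i \<in> S" for i
        using that \<open>p \<in> ?G\<close> by (auto simp: S(2) same_block_def block_permutations_def)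
      then show ?thesis
        by simp
    qed
    show "\<forall>p\<in>{p. p permutes S} - ?G.
        of_int (sign p) * (\<Prod>i\<in>S. b i (p i) * same_block m I i (p i)) = 0"
    proof
      fix p assume "p \<in> {p. p permutes S} - ?G"
      then obtain k i where k: "k \<in> {1..m}" "i \<in> I k" "p i \<notin> I k"
        by (auto simp: S(2) block_permutations_def)
      \<comment> \<open>By disjointness \<open>k\<close> is the only block containing
        \<open>i\<close>, so no other block can contain both \<open>i\<close> and
        \<open>p i\<close>.\<close>
      then have "same_block m I i (p i) = 0"
        using disj unfolding same_block_def disjoint_family_on_def by (metis disjoint_iff)
      moreover have "i \<in> S"
        using k S(2) by blast
      ultimately have "(\<Prod>i\<in>S. b i (p i) * same_block m I i (p i)) = 0"
        using S(1) by (intro prod_zero) auto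
      then show "of_int (sign p) * (\<Prod>i\<in>S. b i (p i) * same_block m I i (p i)) = 0"
        by simp
    qed
  qed
  finally show ?thesis
    using S(1) by (simp add: index_det_Leibniz)
qed

text \<open>Replace \<open>p\<close> by the inverse of \<open>q\<close> composed with
  \<open>p\<close>, whose sign is \<open>sign p * sign q\<close>, and then substitute
  \<open>j = p i\<close> in the product. The inverses appear because the integrand is later grouped
  by variables rather than by rows.\<close>

lemma index_det_permute_columns:
  assumes S: "finite S" and q: "q permutes S"
  shows "(\<Sum>p | p permutes S. of_int (sign p) * of_int (sign q) * (\<Prod>j\<in>S. c (Hilbert_Choice.inv p j) (Hilbert_Choice.inv q j)))
    = index_det S c"
proof -
  have "index_det S c = (\<Sum>p | p permutes S. of_int (sign (Hilbert_Choice.inv q \<circ> p)) *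
      (\<Prod>i\<in>S. c i ((Hilbert_Choice.inv q \<circ> p) i)))"
    unfolding index_det_Leibniz[OF S]
    by (rule setum_permutations_compose_left[OF permutes_inv[OF q]])
  also have "\<dots> = (\<Sum>p | p permutes S.
      of_int (sign p) * of_int (sign q) * (\<Prod>j\<in>S. c (Hilbert_Choice.inv p j) (Hilbert_Choice.inv q j)))"
  proof (rule sum.cong[OF refl])
    fix p assume "p \<in> {p. p permutes S}"
    then have p: "p permutes S"
      by simp
    have perm: "permutation p" "permutation q" "permutation (Hilbert_Choice.inv q)"
      using S p q permutes_inv[OF q] by (auto intro: permutes_imp_permutation)
    have "sign (Hilbert_Choice.inv q \<circ> p) = sign p * sign q"
      using perm by (simp add: sign_compose sign_inverse)
    moreover have "(\<Prod>i\<in>S. c i ((Hilbert_Choice.inv q \<circ> p) i)) = (\<Prod>j\<in>S. c (Hilbert_Choice.inv p j) (Hilbert_Choice.inv q j))"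
      using prod.permute[OF p, of "\<lambda>j. c (Hilbert_Choice.inv p j) (Hilbert_Choice.inv q j)"]
      by (simp add: comp_def permutes_inverses(2)[OF p])
    ultimately show "of_int (sign (Hilbert_Choice.inv q \<circ> p)) * (\<Prod>i\<in>S. c i ((Hilbert_Choice.inv q \<circ> p) i)) =
        of_int (sign p) * of_int (sign q) * (\<Prod>j\<in>S. c (Hilbert_Choice.inv p j) (Hilbert_Choice.inv q j))"
      by simp
  qed
  finally show ?thesis ..
qed

section \<open>The integral identity\<close>

text \<open>One term of the expanded second determinant. Its integral does not depend on
  \<open>q\<close>, so summing over block permutations will merely multiply by their number.
  \<open>has_bochner_integral\<close> carries integrability along with the value.\<close>

lemma has_bochner_integral_det_times_permuted_prod:
  fixes A B :: "nat \<Rightarrow> 'a \<Rightarrow> complex"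
  assumes S: "finite S" and q: "q permutes S"
    and int: "\<And>i j. i \<in> S \<Longrightarrow> j \<in> S \<Longrightarrow> integrable M (\<lambda>x. A i x * B j x)"
  shows "has_bochner_integral (PiM S (\<lambda>_. M))
    (\<lambda>x. index_det S (\<lambda>i j. A i (x j)) * (of_int (sign q) * (\<Prod>i\<in>S. B i (x (q i)))))
    (index_det S (\<lambda>i j. \<integral>x. A i x * B j x \<partial>M))"
proof -
  let ?inv = "Hilbert_Choice.inv"
  \<comment> \<open>The variable \<open>x j\<close> enters the \<open>A\<close> product in row
    \<open>?inv p j\<close> and the \<open>B\<close> product in row \<open>?inv q j\<close>.
    Grouping by \<open>j\<close> leaves a product of functions of one variable each.\<close>
  have expand: "index_det S (\<lambda>i j. A i (x j)) * (of_int (sign q) * (\<Prod>i\<in>S. B i (x (q i)))) =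
      (\<Sum>p | p permutes S. of_int (sign p) * of_int (sign q) *
        (\<Prod>j\<in>S. A (?inv p j) (x j) * B (?inv q j) (x j)))" for x
  proof -
    have reindex: "(\<Prod>i\<in>S. C i (x (p i))) = (\<Prod>j\<in>S. C (?inv p j) (x j))"
      if p: "p permutes S" for p and C :: "nat \<Rightarrow> 'a \<Rightarrow> complex"
      using prod.permute[OF p, of "\<lambda>j. C (?inv p j) (x j)"]
      by (simp add: comp_def permutes_inverses(2)[OF p])
    show ?thesis
      unfolding index_det_Leibniz[OF S] sum_distrib_right reindex[OF q]
      by (intro sum.cong) (auto simp: reindex prod.distrib)
  qed
  have "has_bochner_integral (PiM S (\<lambda>_. M))
      (\<lambda>x. \<Prod>j\<in>S. A (?inv p j) (x j) * B (?inv q j) (x j))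
      (\<Prod>j\<in>S. \<integral>x. A (?inv p j) x * B (?inv q j) x \<partial>M)" if p: "p permutes S" for p
  proof -
    have "integrable M (\<lambda>x. A (?inv p j) x * B (?inv q j) x)" if "j \<in> S" for j
      using that permutes_in_image[OF permutes_inv[OF p]] permutes_in_image[OF permutes_inv[OF q]]
      by (intro int) auto
    then show ?thesis
      using integral_PiM_prod[OF S, of "\<lambda>_. M" "\<lambda>j x. A (?inv p j) x * B (?inv q j) x"]
      by (simp add: has_bochner_integral_iff)
  qed
  then show ?thesis
    unfolding expand
      index_det_permute_columns[OF S q, of "\<lambda>i j. \<integral>x. A i x * B j x \<partial>M", symmetric]
    by (intro has_bochner_integral_sum has_bochner_integral_mult_right) auto
qed

theorem lemma1p2:
  fixes n m :: nat
    and I :: "nat \<Rightarrow> nat set"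
    and \<A> :: "complex set set"
    and X :: "complex set"
    and \<mu> :: "complex measure"
    and A B :: "nat \<Rightarrow> complex \<Rightarrow> complex"
  assumes partition: "partition_on {1..n} (I ` {1..m})" "inj_on I {1..m}"
    and measurable_X: "sigma_algebra UNIV \<A>" "X \<in> \<A>"
    and measure_on_X: "space \<mu> = X" "sets \<mu> = {E \<in> \<A>. E \<subseteq> X}"
    and integrable_AB: "\<And>i j. i \<in> {1..n} \<Longrightarrow> j \<in> {1..n} \<Longrightarrow> integrable \<mu> (\<lambda>x. A i x * B j x)"
  shows
    "(integrable (\<Pi>\<^sub>M i\<in>{1..n}. \<mu>)
        (\<lambda>x. index_det {1..n} (\<lambda>i j. A i (x j)) *
             index_det {1..n} (\<lambda>i j. B i (x j) * same_block m I i j)) \<and>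
      index_det {1..n} (\<lambda>i j. \<integral>x. A i x * B j x \<partial>\<mu>) =
        1 / (\<Prod>k=1..m. fact (card (I k))) *
        (\<integral>x. index_det {1..n} (\<lambda>i j. A i (x j)) *
             index_det {1..n} (\<lambda>i j. B i (x j) * same_block m I i j)
           \<partial>(\<Pi>\<^sub>M i\<in>{1..n}. \<mu>))) \<and>
     (integrable (\<Pi>\<^sub>M i\<in>{1..n}. \<mu>)
        (\<lambda>x. index_det {1..n} (\<lambda>i j. A i (x j)) *
             (\<Prod>k=1..m. index_det (I k) (\<lambda>i j. B i (x j)))) \<and>
      index_det {1..n} (\<lambda>i j. \<integral>x. A i x * B j x \<partial>\<mu>) =
        1 / (\<Prod>k=1..m. fact (card (I k))) *
        (\<integral>x. index_det {1..n} (\<lambda>i j. A i (x j)) *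
             (\<Prod>k=1..m. index_det (I k) (\<lambda>i j. B i (x j)))
           \<partial>(\<Pi>\<^sub>M i\<in>{1..n}. \<mu>)))"
proof -
  let ?S = "{1..n}" and ?G = "block_permutations {1..m} I"
  let ?D = "index_det {1..n} (\<lambda>i j. \<integral>x. A i x * B j x \<partial>\<mu>)"
  let ?F = "\<lambda>x. index_det {1..n} (\<lambda>i j. A i (x j)) * (\<Prod>k=1..m. index_det (I k) (\<lambda>i j. B i (x j)))"
  have cover: "?S = (\<Union>k\<in>{1..m}. I k)"
    by (rule partition_onD1[OF partition(1)])
  have disj: "disjoint_family_on I {1..m}"
    unfolding disjoint_family_on_def
  proof (intro ballI impI)
    \<comment> \<open>Injectivity of \<open>I\<close> passes from disjointness of the set of blocks
      to disjointness of the indexed family.\<close>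
    fix k l assume "k \<in> {1..m}" "l \<in> {1..m}" "k \<noteq> l"
    then show "I k \<inter> I l = {}"
      using inj_onD[OF partition(2), of k l]
      by (intro disjointD[OF partition_onD2[OF partition(1)]]) auto
  qed
  have fin: "finite (I k)" if "k \<in> {1..m}" for k
    by (rule finite_subset[of _ ?S]) (use cover that in blast, simp)
  have block_perm: "q permutes ?S" if "q \<in> ?G" for q
    using that unfolding block_permutations_def cover by simp
  have card_G: "card ?G = (\<Prod>k=1..m. fact (card (I k)))"
    by (intro card_block_permutations finite_atLeastAtMost fin disj)
  have prod_det: "(\<Prod>k=1..m. index_det (I k) b) =
      (\<Sum>q\<in>?G. of_int (sign q) * (\<Prod>i\<in>?S. b i (q i)))" for b :: "nat \<Rightarrow> nat \<Rightarrow> complex"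
    unfolding cover by (intro prod_index_det_blocks finite_atLeastAtMost fin disj)
  have "has_bochner_integral (PiM ?S (\<lambda>_. \<mu>))
      (\<lambda>x. \<Sum>q\<in>?G. index_det ?S (\<lambda>i j. A i (x j)) * (of_int (sign q) * (\<Prod>i\<in>?S. B i (x (q i)))))
      (\<Sum>q\<in>?G. ?D)"
    using integrable_AB block_perm
    by (intro has_bochner_integral_sum has_bochner_integral_det_times_permuted_prod) auto
  then have "has_bochner_integral (PiM ?S (\<lambda>_. \<mu>)) ?F ((\<Prod>k=1..m. fact (card (I k))) * ?D)"
    unfolding prod_det sum_distrib_left[symmetric] sum_constant card_G of_nat_prod of_nat_fact .
  moreover have "(\<Prod>k=1..m. fact (card (I k)) :: complex) \<noteq> 0"
    by simp
  ultimately have "integrable (PiM ?S (\<lambda>_. \<mu>)) ?F \<and>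
      ?D = 1 / (\<Prod>k=1..m. fact (card (I k))) * integral\<^sup>L (PiM ?S (\<lambda>_. \<mu>)) ?F"
    by (simp add: has_bochner_integral_iff)
  \<comment> \<open>Rewriting the masked determinant as the product of block determinants makes both
    halves of the claim the same statement.\<close>
  from this this show ?thesis
    unfolding index_det_same_block[OF finite_atLeastAtMost cover disj] by (rule conjI)
qed

end
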